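(* Let $k$ be a field, $X$ a well-ordered set (all generators of degree $1$), $\mathrm{Lb}(X)$ the free Leibniz algebra over $k$ on $X$, and $\mathrm{MLie}(X)$ the free metabelian Lie algebra over $k$ generated by $X$. Then the set $$S=\{[\mu a_1a_2]_L-[\mu a_2a_1]_L,\ [bac]_L-[cab]_L+[cba]_L,\ [a_1a_2]_L+[a_2a_1]_L,\ [dd]_L\mid \mu\in\mathrm{NF}(X),\ a_1,a_2,a,b,c,d\in X,\ \ell(\mu)\ge2,\ a_2<a_1,\ c<b<a\}$$ is a Gröbner–Shirshov basis in $\mathrm{Lb}(X)$, and the following set forms a linear basis of $\mathrm{MLie}(X)$: $$\{[a_1a_2\cdots a_n]_L\mid a_1,\dots,a_n\in X,\ n\ge1,\ a_1<a_2,\ a_1\le a_3\le a_4\le\cdots\le a_n\}.$$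
   Context: A Leibniz algebra over $k$ is a vector space with bilinear product $(xy)$ satisfying $(x(yz))=((xy)z)-((xz)y)$. A Lie algebra is a Leibniz algebra satisfying $(xx)=0$; it is metabelian if $((x_1x_2)(x_3x_4))=0$ for all $x_1,x_2,x_3,x_4$. $\mathrm{MLie}(X)$ is the free object on $X$ in the class of metabelian Lie algebras. $[f_1\cdots f_n]_L:=((\cdots((f_1f_2)f_3)\cdots)f_n)$. $\mathrm{NF}(X)=\{[a_1\cdots a_n]_L\mid a_i\in X,\ n\ge 1\}$ is a linear basis of $\mathrm{Lb}(X)$; $\ell([a_1\cdots a_n]_L)=\deg([a_1\cdots a_n]_L)=n$. Order: $\mu<\nu$ in $\mathrm{NF}(X)$ iff $(\deg\mu,\ell(\mu),a_1,\dots,a_n)<(\deg\nu,\ell(\nu),b_1,\dots,b_m)$ lexicographically, where $\mu=[a_1\cdots a_n]_L$, $\nu=[b_1\cdots b_m]_L$. $\overline f$ is the leading (largest) monomial of $f\neq0$; $f$ is monic if $\overline f$ has coefficient $1$. Gröbner–Shirshov bases. Let $S\subseteq\mathrm{Lb}(X)$ be a set of monic elements, $s\in S$, $a_1,\dots,a_m\in X$, $m\ge0$. Normal $S$-polynomials are (1) $[sa_1\cdots a_m]_L$, and (2) $[a_1\cdots a_tsa_{t+1}\cdots a_m]_L$ if $\ell(\overline s)=1$, $1\le t\le m$; notation $h_s$. An element is trivial modulo $(S,\mu)$ (resp. $(S,n)$) if it is a linear combination of normal $S$-polynomials with leading monomials $<\mu$ (resp. of degree $\le n$). $S$ is a Gröbner–Shirshov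 basis in $\mathrm{Lb}(X)$ if: for all $f\neq g$ in $S$ with $\overline f=\overline{h_g}$ for a normal $S$-polynomial $h_g$, $f-h_g$ is trivial modulo $(S,\overline f)$; and for all $f\in S$ with $\ell(\overline f)>1$ and $\mu\in\mathrm{NF}(X)$ with $(\mu f)\neq0$, $(\mu f)$ is trivial modulo $(S,\deg\mu+\deg\overline f)$. In the description of the basis, conditions involving $a_i$ with $i>n$ are void (so all $a_1\in X$ occur for $n=1$). *)

theory Defs
  imports
    Complex_Main
    "HOL-Library.Poly_Mapping"
    "HOL-Library.Product_Lexorder"
    "HOL-Library.List_Lexorder"
begin

locale leibniz_algebra = vector_space scale
  for scale :: "'k::field \<Rightarrow> 'v::ab_group_add \<Rightarrow> 'v" +
  fixes mult :: "'v \<Rightarrow> 'v \<Rightarrow> 'v"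
  assumes mult_add_left: "mult (x + y) z = mult x z + mult y z"
    and mult_add_right: "mult x (y + z) = mult x y + mult x z"
    and mult_scale_left: "mult (scale c x) y = scale c (mult x y)"
    and mult_scale_right: "mult x (scale c y) = scale c (mult x y)"
    and leibniz: "mult x (mult y z) = mult (mult x y) z - mult (mult x z) y"

locale lie_algebra = leibniz_algebra +
  assumes mult_self: "mult x x = 0"

locale metabelian_lie_algebra = lie_algebra +
  assumes metabelian: "mult (mult x1 x2) (mult x3 x4) = 0"

definition algebra_hom ::
  "('k::field \<Rightarrow> 'v::ab_group_add \<Rightarrow> 'v) \<Rightarrow> ('v \<Rightarrow> 'v \<Rightarrow> 'v) \<Rightarrow>
   ('k \<Rightarrow> 'w::ab_group_add \<Rightarrow> 'w) \<Rightarrow> ('w \<Rightarrow> 'w \<Rightarrow> 'w) \<Rightarrow> ('v \<Rightarrow> 'w) \<Rightarrow> bool" where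
  "algebra_hom s1 m1 s2 m2 h \<longleftrightarrow>
     Vector_Spaces.linear s1 s2 h \<and> (\<forall>x y. h (m1 x y) = m2 (h x) (h y))"

text \<open>The left-normed bracket \<open>[f\<^sub>1 \<dots> f\<^sub>n]\<^sub>L\<close>, for nonempty lists.\<close>

definition lnormed :: "('v \<Rightarrow> 'v \<Rightarrow> 'v) \<Rightarrow> 'v list \<Rightarrow> 'v" where
  "lnormed m fs = foldl m (hd fs) (tl fs)"

definition linear_basis :: "('k::field \<Rightarrow> 'v::ab_group_add \<Rightarrow> 'v) \<Rightarrow> 'v set \<Rightarrow> bool" where
  "linear_basis scale B \<longleftrightarrow> \<not> module.dependent scale B \<and> module.span scale B = UNIV"


text \<open>
  Normal-form words: \<open>Gen a\<close> is \<open>[a]\<^sub>L\<close> and, for \<open>u = [a\<^sub>1 \<dots> a\<^sub>n]\<^sub>L\<close>,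
  \<open>Snoc u a\<close> is \<open>[a\<^sub>1 \<dots> a\<^sub>n a]\<^sub>L\<close>. The well-ordered set \<open>X\<close> is (the universe of) the type \<open>'x\<close>,
  so the whole type \<open>'x nf\<close> plays the role of \<open>NF(X)\<close>.
\<close>

datatype 'x nf = Gen 'x | Snoc "'x nf" 'x

primrec letters :: "'x nf \<Rightarrow> 'x list" where
  "letters (Gen a) = [a]"
| "letters (Snoc u a) = letters u @ [a]"

definition nf_length :: "'x nf \<Rightarrow> nat" where
  "nf_length \<mu> = length (letters \<mu>)"

text \<open>Every generator has degree 1.\<close>

definition nf_deg :: "'x nf \<Rightarrow> nat" where
  "nf_deg \<mu> = sum_list (map (\<lambda>a. 1) (letters \<mu>))"

lemma letters_nonempty [simp]: "letters \<mu> \<noteq> []"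
  by (cases \<mu>) auto

lemma letters_inject: "letters \<mu> = letters \<nu> \<Longrightarrow> \<mu> = \<nu>"
proof (induction \<mu> arbitrary: \<nu>)
  case (Gen a)
  then show ?case by (cases \<nu>) (auto simp: Cons_eq_append_conv)
next
  case (Snoc u a)
  then show ?case by (cases \<nu>) auto
qed

lemma range_letters: "range letters = {as. as \<noteq> []}"
proof -
  have "as \<noteq> [] \<Longrightarrow> as \<in> range letters" for as :: "'x list"
  proof (induction as rule: rev_nonempty_induct)
    case (single a)
    show ?case by (rule range_eqI[of _ _ "Gen a"]) simp
  next
    case (snoc a as)
    then obtain u where "as = letters u" by auto
    then show ?case by (intro range_eqI[of _ _ "Snoc u a"]) simp
  qed
  then show ?thesis by auto
qed

instantiation nf :: (linorder) linorder
begin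

definition less_nf :: "'a nf \<Rightarrow> 'a nf \<Rightarrow> bool" where
  "\<mu> < \<nu> \<longleftrightarrow> (nf_deg \<mu>, nf_length \<mu>, letters \<mu>) < (nf_deg \<nu>, nf_length \<nu>, letters \<nu>)"

definition less_eq_nf :: "'a nf \<Rightarrow> 'a nf \<Rightarrow> bool" where
  "(\<mu> :: 'a nf) \<le> \<nu> \<longleftrightarrow> \<mu> < \<nu> \<or> \<mu> = \<nu>"

instance
  by standard (auto simp: less_nf_def less_eq_nf_def dest: letters_inject not_less_iff_gr_or_eq[THEN iffD1])

end


text \<open>
  The free Leibniz algebra, realised on finitely supported functions \<open>NF(X) \<rightarrow> k\<close>.
\<close>

type_synonym ('x, 'k) lb = "'x nf \<Rightarrow>\<^sub>0 'k"

definition lb_scale :: "'k::field \<Rightarrow> ('x, 'k) lb \<Rightarrow> ('x, 'k) lb" where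
  "lb_scale c f = Poly_Mapping.map ((*) c) f"

definition lb_mono :: "'x nf \<Rightarrow> ('x, 'k::field) lb" where
  "lb_mono \<mu> = Poly_Mapping.single \<mu> 1"

definition lb_gen :: "'x \<Rightarrow> ('x, 'k::field) lb" where
  "lb_gen a = lb_mono (Gen a)"

text \<open>Linear extension of a map defined on a basis.\<close>

definition lin_ext :: "('k::field \<Rightarrow> 'v::ab_group_add \<Rightarrow> 'v) \<Rightarrow> ('w \<Rightarrow> 'v) \<Rightarrow> ('w \<Rightarrow>\<^sub>0 'k) \<Rightarrow> 'v" where
  "lin_ext sc \<phi> f = (\<Sum>w\<in>Poly_Mapping.keys f. sc (Poly_Mapping.lookup f w) (\<phi> w))"

text \<open>
  \<open>lb_rmult w f\<close> is the product \<open>(f w)\<close>; its second equation is the Leibniz identity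
  \<open>(f (v a)) = ((f v) a) - ((f a) v)\<close>.
\<close>

primrec lb_rmult :: "'x nf \<Rightarrow> ('x, 'k::field) lb \<Rightarrow> ('x, 'k) lb" where
  "lb_rmult (Gen a) = lin_ext lb_scale (\<lambda>u. lb_mono (Snoc u a))"
| "lb_rmult (Snoc v a) = (\<lambda>f.
     lin_ext lb_scale (\<lambda>u. lb_mono (Snoc u a)) (lb_rmult v f)
     - lb_rmult v (lin_ext lb_scale (\<lambda>u. lb_mono (Snoc u a)) f))"

definition lb_mult :: "('x, 'k::field) lb \<Rightarrow> ('x, 'k) lb \<Rightarrow> ('x, 'k) lb" where
  "lb_mult f g = lin_ext lb_scale (\<lambda>w. lb_rmult w f) g"

lemma lookup_lb_scale [simp]:
  "Poly_Mapping.lookup (lb_scale c f) w = c * Poly_Mapping.lookup f w"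
  by (simp add: lb_scale_def Poly_Mapping.map.rep_eq when_def)

interpretation lb: vector_space "lb_scale :: 'k::field \<Rightarrow> ('x, 'k) lb \<Rightarrow> ('x, 'k) lb"
  by standard (auto intro!: poly_mapping_eqI simp: lookup_add algebra_simps)

lemma lb_scale_single [simp]:
  "lb_scale c (Poly_Mapping.single w d) = Poly_Mapping.single w (c * d)"
  by (rule poly_mapping_eqI) (simp add: lookup_single when_def)

context vector_space
begin

lemma lin_ext_superset:
  assumes "finite A" "Poly_Mapping.keys f \<subseteq> A"
  shows "lin_ext scale \<phi> f = (\<Sum>w\<in>A. scale (Poly_Mapping.lookup f w) (\<phi> w))"
  unfolding lin_ext_def using assms
  by (intro sum.mono_neutral_left) (auto simp: in_keys_iff)

lemma lin_ext_add: "lin_ext scale \<phi> (f + g) = lin_ext scale \<phi> f + lin_ext scale \<phi> g"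
proof -
  let ?A = "Poly_Mapping.keys f \<union> Poly_Mapping.keys g"
  have "Poly_Mapping.keys (f + g) \<subseteq> ?A"
    by (rule Poly_Mapping.keys_add)
  then show ?thesis
    by (simp add: lin_ext_superset[of ?A] lookup_add scale_left_distrib sum.distrib)
qed

lemma lin_ext_scale: "lin_ext scale \<phi> (lb_scale c f) = scale c (lin_ext scale \<phi> f)"
proof -
  have "Poly_Mapping.keys (lb_scale c f) \<subseteq> Poly_Mapping.keys f"
    by (auto simp: in_keys_iff)
  then show ?thesis
    by (simp add: lin_ext_superset[of "Poly_Mapping.keys f"] scale_sum_right)
qed

lemma lin_ext_single [simp]: "lin_ext scale \<phi> (Poly_Mapping.single w c) = scale c (\<phi> w)"
  by (simp add: lin_ext_def)

lemma linear_lin_ext: "Vector_Spaces.linear lb_scale scale (lin_ext scale \<phi>)"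
  by unfold_locales (simp_all add: lin_ext_add lin_ext_scale)

end

lemma lb_eq_sum:
  "f = (\<Sum>w\<in>Poly_Mapping.keys f. lb_scale (Poly_Mapping.lookup f w) (lb_mono w))"
proof (rule poly_mapping_eqI)
  fix v
  have "Poly_Mapping.lookup (\<Sum>w\<in>Poly_Mapping.keys f. lb_scale (Poly_Mapping.lookup f w) (lb_mono w)) v
    = (\<Sum>w\<in>Poly_Mapping.keys f. if w = v then Poly_Mapping.lookup f v else 0)"
    by (auto simp: lookup_sum lb_mono_def lookup_single when_def intro!: sum.cong)
  also have "\<dots> = Poly_Mapping.lookup f v"
    by (simp add: in_keys_iff)
  finally show "Poly_Mapping.lookup f v = Poly_Mapping.lookup
    (\<Sum>w\<in>Poly_Mapping.keys f. lb_scale (Poly_Mapping.lookup f w) (lb_mono w)) v" ..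
qed

lemma linear_eq_on_mono:
  assumes h: "Vector_Spaces.linear lb_scale sc h" and h': "Vector_Spaces.linear lb_scale sc h'"
    and eq: "\<And>w. h (lb_mono w) = h' (lb_mono w)"
  shows "h f = h' f"
proof -
  interpret h: Vector_Spaces.linear lb_scale sc h by (rule h)
  interpret h': Vector_Spaces.linear lb_scale sc h' by (rule h')
  show ?thesis
    by (subst (1 2) lb_eq_sum[of f]) (simp add: h.sum h'.sum h.scale h'.scale eq)
qed

lemma linear_lb_rmult:
  "Vector_Spaces.linear lb_scale lb_scale (lb_rmult w :: ('x, 'k::field) lb \<Rightarrow> ('x, 'k) lb)"
proof (induction w)
  case (Gen a)
  show ?case by (simp add: lb.linear_lin_ext)
next
  case (Snoc v a)
  interpret v: Vector_Spaces.linear lb_scale lb_scale "lb_rmult v :: ('x, 'k) lb \<Rightarrow> ('x, 'k) lb"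
    by (rule Snoc)
  show ?case
    by unfold_locales
      (simp_all add: lb.lin_ext_add lb.lin_ext_scale v.add v.scale algebra_simps
        lb.scale_right_diff_distrib)
qed

interpretation lb_rmult: Vector_Spaces.linear lb_scale lb_scale "lb_rmult w"
  by (rule linear_lb_rmult)

lemma linear_lb_mult_right: "Vector_Spaces.linear lb_scale lb_scale (lb_mult f)"
  unfolding lb_mult_def by (rule lb.linear_lin_ext)

lemma linear_lb_mult_left: "Vector_Spaces.linear lb_scale lb_scale (\<lambda>f. lb_mult f g)"
  by unfold_locales
    (simp_all add: lb_mult_def lin_ext_def lb_rmult.add lb_rmult.scale
      lb.scale_right_distrib sum.distrib lb.scale_sum_right mult.commute)

interpretation lb_multR: Vector_Spaces.linear lb_scale lb_scale "lb_mult f"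
  by (rule linear_lb_mult_right)

interpretation lb_multL: Vector_Spaces.linear lb_scale lb_scale "\<lambda>f. lb_mult f g"
  by (rule linear_lb_mult_left)

lemma lb_mult_mono_right: "lb_mult f (lb_mono w) = lb_rmult w f"
  by (simp add: lb_mult_def lb_mono_def)

lemma lb_rmult_Snoc:
  "lb_rmult (Snoc v a) f = lb_rmult (Gen a) (lb_rmult v f) - lb_rmult v (lb_rmult (Gen a) f)"
  by simp

lemma lb_rmult_Gen_mono: "lb_rmult (Gen a) (lb_mono w) = lb_mono (Snoc w a)"
  by (simp add: lb_mono_def)

lemma lb_mult_mono_gen: "lb_mult (lb_mono w) (lb_gen a) = lb_mono (Snoc w a)"
  by (simp only: lb_gen_def lb_mult_mono_right lb_rmult_Gen_mono)

declare lb_rmult.simps [simp del]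

lemma lb_leibniz_gen:
  "lb_mult f (lb_rmult (Gen a) y) = lb_rmult (Gen a) (lb_mult f y) - lb_mult (lb_rmult (Gen a) f) y"
proof (rule linear_eq_on_mono[where f = y])
  show "Vector_Spaces.linear lb_scale lb_scale (\<lambda>y. lb_mult f (lb_rmult (Gen a) y))"
    by unfold_locales
      (simp_all add: lb_rmult.add lb_rmult.scale lb_multR.add lb_multR.scale)
  show "Vector_Spaces.linear lb_scale lb_scale
      (\<lambda>y. lb_rmult (Gen a) (lb_mult f y) - lb_mult (lb_rmult (Gen a) f) y)"
    by unfold_locales
      (simp_all add: lb_rmult.add lb_rmult.scale lb_multR.add lb_multR.scale
        lb.scale_right_diff_distrib)
qed (simp add: lb_rmult_Gen_mono lb_mult_mono_right lb_rmult_Snoc)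

lemma lb_leibniz_mono:
  "lb_mult f (lb_rmult z y) = lb_rmult z (lb_mult f y) - lb_mult (lb_rmult z f) y"
proof (induction z arbitrary: f y)
  case (Gen a)
  show ?case by (rule lb_leibniz_gen)
next
  case (Snoc v a)
  show ?case
    by (simp add: lb_rmult_Snoc lb_multR.diff lb_multL.diff lb_rmult.diff Snoc lb_leibniz_gen)
qed

interpretation lb: leibniz_algebra
  "lb_scale :: 'k::field \<Rightarrow> ('x, 'k) lb \<Rightarrow> ('x, 'k) lb" lb_mult
proof unfold_locales
  fix x y z :: "('x, 'k) lb"
  show "lb_mult x (lb_mult y z) = lb_mult (lb_mult x y) z - lb_mult (lb_mult x z) y"
  proof (rule linear_eq_on_mono[where f = z])
    show "Vector_Spaces.linear lb_scale lb_scale (\<lambda>z. lb_mult x (lb_mult y z))"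
      by unfold_locales (simp_all add: lb_multR.add lb_multR.scale)
    show "Vector_Spaces.linear lb_scale lb_scale
        (\<lambda>z. lb_mult (lb_mult x y) z - lb_mult (lb_mult x z) y)"
      by unfold_locales
        (simp_all add: lb_multR.add lb_multR.scale lb_multL.add lb_multL.scale
          lb.scale_right_diff_distrib)
  qed (simp add: lb_mult_mono_right lb_leibniz_mono)
qed (simp_all add: lb_multR.add lb_multR.scale lb_multL.add lb_multL.scale)

lemma lnormed_snoc: "fs \<noteq> [] \<Longrightarrow> lnormed m (fs @ [g]) = m (lnormed m fs) g"
  by (simp add: lnormed_def)

lemma lb_mono_eq_lnormed: "lb_mono \<mu> = lnormed lb_mult (map lb_gen (letters \<mu>))"
proof (induction \<mu>)
  case (Gen a)
  show ?case by (simp add: lnormed_def lb_gen_def)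
next
  case (Snoc u a)
  then show ?case by (simp add: lnormed_snoc flip: lb_mult_mono_gen)
qed

lemma hom_lnormed:
  assumes "\<And>x y. h (m x y) = m' (h x) (h y)" "fs \<noteq> []"
  shows "h (lnormed m fs) = lnormed m' (map h fs)"
  using assms(2) by (induction fs rule: rev_nonempty_induct)
    (simp_all add: lnormed_snoc assms(1), simp add: lnormed_def)

text \<open>The universal property, for target algebras of arbitrary type.\<close>

theorem lb_free:
  fixes sc :: "'k::field \<Rightarrow> 'v::ab_group_add \<Rightarrow> 'v" and \<phi> :: "'x \<Rightarrow> 'v"
  assumes "leibniz_algebra sc m"
  shows "\<exists>!h. algebra_hom lb_scale lb_mult sc m h \<and> (\<forall>a. h (lb_gen a) = \<phi> a)"
proof (rule ex_ex1I)
  interpret A: leibniz_algebra sc m by (rule assms)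
  interpret mR: Vector_Spaces.linear sc sc "m x" for x
    by unfold_locales (simp_all add: A.mult_add_right A.mult_scale_right)
  interpret mL: Vector_Spaces.linear sc sc "\<lambda>x. m x y" for y
    by unfold_locales (simp_all add: A.mult_add_left A.mult_scale_left)
  define h :: "('x, 'k) lb \<Rightarrow> 'v" where
    "h = lin_ext sc (\<lambda>w. lnormed m (map \<phi> (letters w)))"
  have lin: "Vector_Spaces.linear lb_scale sc h"
    unfolding h_def by (rule A.linear_lin_ext)
  interpret h: Vector_Spaces.linear lb_scale sc h by (rule lin)
  have h_mono: "h (lb_mono w) = lnormed m (map \<phi> (letters w))" for w
    by (simp add: h_def lb_mono_def)
  have h_gen: "h (lb_gen a) = \<phi> a" for a
    by (simp add: lb_gen_def h_mono lnormed_def)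
  have h_rGen: "h (lb_rmult (Gen a) f) = m (h f) (\<phi> a)" for a f
  proof (rule linear_eq_on_mono[where f = f])
    show "Vector_Spaces.linear lb_scale sc (\<lambda>f. h (lb_rmult (Gen a) f))"
      by unfold_locales (simp_all add: lb_rmult.add lb_rmult.scale h.add h.scale)
    show "Vector_Spaces.linear lb_scale sc (\<lambda>f. m (h f) (\<phi> a))"
      by unfold_locales (simp_all add: h.add h.scale mL.add mL.scale)
  qed (simp add: lb_rmult_Gen_mono h_mono lnormed_snoc)
  have h_rmult: "h (lb_rmult w f) = m (h f) (h (lb_mono w))" for w f
  proof (induction w arbitrary: f)
    case (Gen a)
    show ?case by (simp add: h_rGen h_mono lnormed_def)
  next
    case (Snoc v a)
    have "h (lb_mono (Snoc v a)) = m (h (lb_mono v)) (\<phi> a)"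
      by (simp add: h_mono lnormed_snoc)
    then show ?case
      by (simp add: lb_rmult_Snoc h.diff h_rGen Snoc A.leibniz)
  qed
  have "h (lb_mult f g) = m (h f) (h g)" for f g
  proof (rule linear_eq_on_mono[where f = g])
    show "Vector_Spaces.linear lb_scale sc (\<lambda>g. h (lb_mult f g))"
      by unfold_locales (simp_all add: lb_multR.add lb_multR.scale h.add h.scale)
    show "Vector_Spaces.linear lb_scale sc (\<lambda>g. m (h f) (h g))"
      by unfold_locales (simp_all add: h.add h.scale mR.add mR.scale)
  qed (simp add: lb_mult_mono_right h_rmult)
  then show "\<exists>h. algebra_hom lb_scale lb_mult sc m h \<and> (\<forall>a. h (lb_gen a) = \<phi> a)"
    unfolding algebra_hom_def using lin h_gen by blast
next
  fix h h' :: "('x, 'k) lb \<Rightarrow> 'v"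
  assume h: "algebra_hom lb_scale lb_mult sc m h \<and> (\<forall>a. h (lb_gen a) = \<phi> a)"
    and h': "algebra_hom lb_scale lb_mult sc m h' \<and> (\<forall>a. h' (lb_gen a) = \<phi> a)"
  have "h (lb_mono w) = h' (lb_mono w)" for w
    using h h' by (simp add: lb_mono_eq_lnormed algebra_hom_def o_def
        hom_lnormed[of h lb_mult m] hom_lnormed[of h' lb_mult m])
  then show "h = h'"
    using linear_eq_on_mono h h' unfolding algebra_hom_def by blast
qed


text \<open>
  The free metabelian Lie algebra: the quotient of the free Leibniz algebra by the ideal
  generated by all values of \<open>(xx)\<close> and \<open>((x\<^sub>1x\<^sub>2)(x\<^sub>3x\<^sub>4))\<close>.
\<close>

inductive_set mlie_ideal :: "('x, 'k::field) lb set" where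
  square: "lb_mult x x \<in> mlie_ideal"
| metabelian: "lb_mult (lb_mult x1 x2) (lb_mult x3 x4) \<in> mlie_ideal"
| add: "f \<in> mlie_ideal \<Longrightarrow> g \<in> mlie_ideal \<Longrightarrow> f + g \<in> mlie_ideal"
| scale: "f \<in> mlie_ideal \<Longrightarrow> lb_scale c f \<in> mlie_ideal"
| mult_left: "f \<in> mlie_ideal \<Longrightarrow> lb_mult g f \<in> mlie_ideal"
| mult_right: "f \<in> mlie_ideal \<Longrightarrow> lb_mult f g \<in> mlie_ideal"

definition mlie_rel :: "('x, 'k::field) lb \<Rightarrow> ('x, 'k) lb \<Rightarrow> bool" where
  "mlie_rel f g \<longleftrightarrow> f - g \<in> mlie_ideal"

lemma mlie_ideal_zero: "0 \<in> mlie_ideal"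
  using mlie_ideal.square[of 0] by (simp add: lb_multR.zero)

lemma mlie_ideal_uminus: "f \<in> mlie_ideal \<Longrightarrow> - f \<in> mlie_ideal"
  using mlie_ideal.scale[of f "-1"] by simp

lemma mlie_ideal_diff: "f \<in> mlie_ideal \<Longrightarrow> g \<in> mlie_ideal \<Longrightarrow> f - g \<in> mlie_ideal"
  using mlie_ideal.add[of f "- g"] mlie_ideal_uminus[of g] by simp

lemma equivp_mlie_rel: "equivp mlie_rel"
proof (rule equivpI)
  show "reflp mlie_rel"
    by (simp add: reflp_def mlie_rel_def mlie_ideal_zero)
  show "symp mlie_rel"
    unfolding symp_def mlie_rel_def using mlie_ideal_uminus by (metis minus_diff_eq)
  show "transp mlie_rel"
  proof (rule transpI)
    fix f g h
    assume "mlie_rel f g" "mlie_rel g h"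
    then show "mlie_rel f h"
      unfolding mlie_rel_def using mlie_ideal.add[of "f - g" "g - h"] by simp
  qed
qed

quotient_type (overloaded) ('x, 'k) mlie = "'x nf \<Rightarrow>\<^sub>0 ('k::field)" / mlie_rel
  by (rule equivp_mlie_rel)

instantiation mlie :: (type, field) ab_group_add
begin

lift_definition zero_mlie :: "('a, 'b) mlie" is 0 .

lift_definition plus_mlie :: "('a, 'b) mlie \<Rightarrow> ('a, 'b) mlie \<Rightarrow> ('a, 'b) mlie" is "(+)"
proof -
  fix f f' g g' :: "('a, 'b) lb"
  assume "mlie_rel f f'" "mlie_rel g g'"
  then show "mlie_rel (f + g) (f' + g')"
    unfolding mlie_rel_def using mlie_ideal.add[of "f - f'" "g - g'"] by (simp add: add_diff_add)
qed

lift_definition uminus_mlie :: "('a, 'b) mlie \<Rightarrow> ('a, 'b) mlie" is uminus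
proof -
  fix f f' :: "('a, 'b) lb"
  assume "mlie_rel f f'"
  then show "mlie_rel (- f) (- f')"
    unfolding mlie_rel_def using mlie_ideal_uminus[of "f - f'"] by simp
qed

lift_definition minus_mlie :: "('a, 'b) mlie \<Rightarrow> ('a, 'b) mlie \<Rightarrow> ('a, 'b) mlie" is "(-)"
proof -
  fix f f' g g' :: "('a, 'b) lb"
  assume "mlie_rel f f'" "mlie_rel g g'"
  then have "(f - f') - (g - g') \<in> mlie_ideal"
    unfolding mlie_rel_def by (rule mlie_ideal_diff)
  moreover have "(f - f') - (g - g') = (f - g) - (f' - g')"
    by simp
  ultimately show "mlie_rel (f - g) (f' - g')"
    by (simp only: mlie_rel_def)
qed

instance
  by standard (transfer, simp add: mlie_rel_def mlie_ideal_zero algebra_simps)+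

end

lift_definition mlie_scale :: "'k::field \<Rightarrow> ('x, 'k) mlie \<Rightarrow> ('x, 'k) mlie" is lb_scale
  unfolding mlie_rel_def using mlie_ideal.scale by (metis lb.scale_right_diff_distrib)

lift_definition mlie_mult :: "('x, 'k::field) mlie \<Rightarrow> ('x, 'k) mlie \<Rightarrow> ('x, 'k) mlie" is lb_mult
proof -
  fix f f' g g' :: "('x, 'k) lb"
  assume "mlie_rel f f'" "mlie_rel g g'"
  then have "lb_mult (f - f') g + lb_mult f' (g - g') \<in> mlie_ideal"
    unfolding mlie_rel_def by (intro mlie_ideal.add mlie_ideal.mult_left mlie_ideal.mult_right)
  then show "mlie_rel (lb_mult f g) (lb_mult f' g')"
    by (simp add: mlie_rel_def lb_multL.diff lb_multR.diff)
qed

lift_definition mlie_gen :: "'x \<Rightarrow> ('x, 'k::field) mlie" is lb_gen .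

lemma mlie_rel_refl [simp]: "mlie_rel f f"
  by (simp add: mlie_rel_def mlie_ideal_zero)

interpretation mlie: metabelian_lie_algebra
  "mlie_scale :: 'k::field \<Rightarrow> ('x, 'k) mlie \<Rightarrow> ('x, 'k) mlie" mlie_mult
proof unfold_locales
  fix x x1 x2 x3 x4 :: "('x, 'k) mlie"
  show "mlie_mult x x = 0"
    by transfer (simp add: mlie_rel_def mlie_ideal.square)
  show "mlie_mult (mlie_mult x1 x2) (mlie_mult x3 x4) = 0"
    by transfer (simp add: mlie_rel_def mlie_ideal.metabelian)
qed (transfer, simp add: lb.scale_right_distrib lb.scale_left_distrib
      lb_multR.add lb_multL.add lb_multR.scale lb_multL.scale lb.leibniz)+

text \<open>The universal property, for target algebras of arbitrary type.\<close>

theorem mlie_free: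
  fixes sc :: "'k::field \<Rightarrow> 'v::ab_group_add \<Rightarrow> 'v" and \<phi> :: "'x \<Rightarrow> 'v"
  assumes "metabelian_lie_algebra sc m"
  shows "\<exists>!h. algebra_hom mlie_scale mlie_mult sc m h \<and> (\<forall>a. h (mlie_gen a) = \<phi> a)"
proof (rule ex_ex1I)
  interpret A: metabelian_lie_algebra sc m by (rule assms)
  obtain h where h: "algebra_hom lb_scale lb_mult sc m h" and h_gen: "\<And>a. h (lb_gen a) = \<phi> a"
    using lb_free[OF A.leibniz_algebra_axioms, of \<phi>] by blast
  interpret h: Vector_Spaces.linear lb_scale sc h
    using h by (simp add: algebra_hom_def)
  have h_mult: "h (lb_mult x y) = m (h x) (h y)" for x y
    using h by (simp add: algebra_hom_def)
  have m_zero: "m x 0 = 0" "m 0 x = 0" for x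
    using A.mult_scale_right[of x 0 0] A.mult_scale_left[of 0 0 x] by simp_all
  have h_ideal: "h f = 0" if "f \<in> mlie_ideal" for f
    using that
    by induction (simp_all add: h_mult A.mult_self A.metabelian h.add h.scale m_zero)
  define k where "k x = h (rep_mlie x)" for x
  have k_abs: "k (abs_mlie f) = h f" for f
  proof -
    have "mlie_rel (rep_mlie (abs_mlie f)) f"
      by (meson Quotient3_mlie rep_abs_rsp_left mlie_rel_refl)
    then have "h (rep_mlie (abs_mlie f) - f) = 0"
      unfolding mlie_rel_def by (rule h_ideal)
    then show ?thesis by (simp add: k_def h.diff)
  qed
  have "Vector_Spaces.linear mlie_scale sc k"
  proof unfold_locales
    fix x y :: "('x, 'k) mlie" and c
    obtain f g where fg: "x = abs_mlie f" "y = abs_mlie g"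
      by (metis Quotient3_mlie Quotient3_abs_rep)
    show "k (x + y) = k x + k y"
      by (simp add: fg plus_mlie.abs_eq k_abs h.add)
    show "k (mlie_scale c x) = sc c (k x)"
      by (simp add: fg mlie_scale.abs_eq k_abs h.scale)
  qed
  moreover have "k (mlie_mult x y) = m (k x) (k y)" for x y
  proof -
    obtain f g where fg: "x = abs_mlie f" "y = abs_mlie g"
      by (metis Quotient3_mlie Quotient3_abs_rep)
    show ?thesis by (simp add: fg mlie_mult.abs_eq k_abs h_mult)
  qed
  moreover have "k (mlie_gen a) = \<phi> a" for a
    by (simp add: mlie_gen_def k_abs h_gen)
  ultimately show "\<exists>h. algebra_hom mlie_scale mlie_mult sc m h \<and> (\<forall>a. h (mlie_gen a) = \<phi> a)"
    unfolding algebra_hom_def by blast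
next
  interpret A: metabelian_lie_algebra sc m by (rule assms)
  fix h h' :: "('x, 'k) mlie \<Rightarrow> 'v"
  assume h: "algebra_hom mlie_scale mlie_mult sc m h \<and> (\<forall>a. h (mlie_gen a) = \<phi> a)"
    and h': "algebra_hom mlie_scale mlie_mult sc m h' \<and> (\<forall>a. h' (mlie_gen a) = \<phi> a)"
  have lift: "algebra_hom lb_scale lb_mult sc m (\<lambda>f. k (abs_mlie f)) \<and>
      (\<forall>a. k (abs_mlie (lb_gen a)) = \<phi> a)"
    if k: "algebra_hom mlie_scale mlie_mult sc m k \<and> (\<forall>a. k (mlie_gen a) = \<phi> a)"
    for k :: "('x, 'k) mlie \<Rightarrow> 'v"
  proof -
    interpret k: Vector_Spaces.linear mlie_scale sc k
      using k by (simp add: algebra_hom_def)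
    have "Vector_Spaces.linear lb_scale sc (\<lambda>f. k (abs_mlie f))"
      by unfold_locales
        (simp_all add: k.add k.scale flip: plus_mlie.abs_eq mlie_scale.abs_eq)
    then show ?thesis
      using k by (simp add: algebra_hom_def mlie_gen_def flip: mlie_mult.abs_eq)
  qed
  have "(\<lambda>f. h (abs_mlie f)) = (\<lambda>f. h' (abs_mlie f))"
    using lb_free[OF A.leibniz_algebra_axioms, of \<phi>] lift[OF h] lift[OF h'] by blast
  then show "h = h'"
    by (metis Quotient3_mlie Quotient3_abs_rep ext)
qed


text \<open>Only meaningful for \<open>f \<noteq> 0\<close>.\<close>

definition lead :: "('x::linorder, 'k::field) lb \<Rightarrow> 'x nf" where
  "lead f = Max (Poly_Mapping.keys f)"

definition monic :: "('x::linorder, 'k::field) lb \<Rightarrow> bool" where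
  "monic f \<longleftrightarrow> f \<noteq> 0 \<and> Poly_Mapping.lookup f (lead f) = 1"

text \<open>
  The normal polynomials \<open>h\<^sub>s\<close> of a given \<open>s\<close>; they are nonzero whenever \<open>s\<close> is monic.
\<close>

definition normal_polys_of :: "('x::linorder, 'k::field) lb \<Rightarrow> ('x, 'k) lb set" where
  "normal_polys_of s =
     {lnormed lb_mult (s # map lb_gen as) | as. True}
     \<union> {lnormed lb_mult (map lb_gen as @ s # map lb_gen bs) | as bs.
          as \<noteq> [] \<and> nf_length (lead s) = 1}"

definition normal_polys :: "('x::linorder, 'k::field) lb set \<Rightarrow> ('x, 'k) lb set" where
  "normal_polys S = (\<Union>s\<in>S. normal_polys_of s)"

definition trivial_mod ::
  "('x::linorder, 'k::field) lb set \<Rightarrow> 'x nf \<Rightarrow> ('x, 'k) lb \<Rightarrow> bool" where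
  "trivial_mod S \<mu> f \<longleftrightarrow> f \<in> lb.span {h \<in> normal_polys S. lead h < \<mu>}"

definition trivial_mod_deg ::
  "('x::linorder, 'k::field) lb set \<Rightarrow> nat \<Rightarrow> ('x, 'k) lb \<Rightarrow> bool" where
  "trivial_mod_deg S n f \<longleftrightarrow> f \<in> lb.span {h \<in> normal_polys S. nf_deg (lead h) \<le> n}"

definition groebner_shirshov_basis :: "('x::wellorder, 'k::field) lb set \<Rightarrow> bool" where
  "groebner_shirshov_basis S \<longleftrightarrow>
     (\<forall>s\<in>S. monic s) \<and>
     (\<forall>f\<in>S. \<forall>g\<in>S. \<forall>h\<in>normal_polys_of g.
        f \<noteq> g \<and> lead f = lead h \<longrightarrow> trivial_mod S (lead f) (f - h)) \<and>
     (\<forall>f\<in>S. \<forall>\<mu>. nf_length (lead f) > 1 \<and> lb_mult (lb_mono \<mu>) f \<noteq> 0 \<longrightarrow>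
        trivial_mod_deg S (nf_deg \<mu> + nf_deg (lead f)) (lb_mult (lb_mono \<mu>) f))"

definition mlie_relators :: "('x::wellorder, 'k::field) lb set" where
  "mlie_relators =
     {lnormed lb_mult [lb_mono \<mu>, lb_gen a1, lb_gen a2]
        - lnormed lb_mult [lb_mono \<mu>, lb_gen a2, lb_gen a1] | \<mu> a1 a2.
        nf_length \<mu> \<ge> 2 \<and> a2 < a1}
     \<union> {lnormed lb_mult [lb_gen b, lb_gen a, lb_gen c]
        - lnormed lb_mult [lb_gen c, lb_gen a, lb_gen b]
        + lnormed lb_mult [lb_gen c, lb_gen b, lb_gen a] | a b c. c < b \<and> b < a}
     \<union> {lnormed lb_mult [lb_gen a1, lb_gen a2] + lnormed lb_mult [lb_gen a2, lb_gen a1] | a1 a2.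
        a2 < a1}
     \<union> {lnormed lb_mult [lb_gen d, lb_gen d] | d. True}"

text \<open>
  The words \<open>a\<^sub>1 \<dots> a\<^sub>n\<close> with \<open>a\<^sub>1 < a\<^sub>2\<close> and \<open>a\<^sub>1 \<le> a\<^sub>3 \<le> \<dots> \<le> a\<^sub>n\<close>
  (list positions are counted from 0).
\<close>

definition mlie_basis_words :: "'x::wellorder list set" where
  "mlie_basis_words =
     {as. as \<noteq> [] \<and> (length as \<ge> 2 \<longrightarrow> as ! 0 < as ! 1) \<and> sorted (hd as # drop 2 as)}"

end

theory Submission
  imports Defs "HOL-Library.Multiset" "HOL-Library.Function_Algebras" "HOL-Library.Product_Plus"
begin

text \<open>
  Let \<open>R = k[X]\<close>. The space \<open>R \<times> R\<^sup>X\<close> with bracket \<open>(p,t)(q,s) = (0, tq - sp)\<close> is a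
  metabelian Lie algebra, and \<open>x \<mapsto> (x, e\<^sub>x)\<close> sends \<open>[a\<^sub>1 \<dots> a\<^sub>n]\<^sub>L\<close>, \<open>n \<ge> 2\<close>, to
  \<open>(e\<^bsub>a\<^sub>1\<^esub> a\<^sub>2 - e\<^bsub>a\<^sub>2\<^esub> a\<^sub>1) a\<^sub>3 \<dots> a\<^sub>n\<close>. Among the \<open>e\<^sub>y m\<close> with \<open>y > min m\<close>, a basis word
  contributes exactly one, \<open>e\<^bsub>a\<^sub>2\<^esub> a\<^sub>1 a\<^sub>3 \<dots> a\<^sub>n\<close>, and it can be recovered from it. So the basis words
  are linearly independent in \<open>MLie(X)\<close>.

  On the other hand, every word is congruent to a combination of basis words modulo normal
  polynomials whose leading words do not exceed it. Hence an element of the ideal that involves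
  only words below a bound is a combination of normal polynomials below that bound. This settles
  all compositions at once, without computing any of them.
\<close>

section \<open>A metabelian Lie algebra of Magnus type\<close>

text \<open>A multiset of letters is a commutative monomial, so finitely supported functions on
  multisets, with convolution, form the polynomial ring \<open>R\<close>. The second factor consists
  of all functions from letters to \<open>R\<close>, which avoids a side condition on finite
  support.\<close>

type_synonym ('x, 'k) magnus =
  "('x multiset \<Rightarrow>\<^sub>0 'k) \<times> ('x \<Rightarrow> 'x multiset \<Rightarrow>\<^sub>0 'k)"

definition magnus_scale :: "'k::field \<Rightarrow> ('x, 'k) magnus \<Rightarrow> ('x, 'k) magnus" where
  "magnus_scale c v = (Poly_Mapping.single 0 c * fst v, \<lambda>y. Poly_Mapping.single 0 c * snd v y)"

definition magnus_mult :: "('x, 'k::field) magnus \<Rightarrow> ('x, 'k) magnus \<Rightarrow> ('x, 'k) magnus" where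
  "magnus_mult v w = (0, \<lambda>y. snd v y * fst w - snd w y * fst v)"

definition magnus_gen :: "'x \<Rightarrow> ('x, 'k::field) magnus" where
  "magnus_gen a = (Poly_Mapping.single {#a#} 1, \<lambda>y. if y = a then 1 else 0)"

text \<open>Every product has first component 0, and the bracket of two such elements vanishes; this
  gives the metabelian identity. The Leibniz identity rests on the commutativity of
  \<open>R\<close>.\<close>

interpretation magnus: metabelian_lie_algebra
  "magnus_scale :: 'k::field \<Rightarrow> ('x, 'k) magnus \<Rightarrow> ('x, 'k) magnus" magnus_mult
  by unfold_locales
    (auto simp: magnus_scale_def magnus_mult_def prod_eq_iff fun_eq_iff single_add
      algebra_simps mult_single)

text \<open>After the first bracket the first component is 0, so each further generator acts simply
  as multiplication by its variable.\<close>

lemma lnormed_magnus_gen: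
  "lnormed magnus_mult (map magnus_gen (a # b # cs)) =
    (0, \<lambda>y. (if y = a then Poly_Mapping.single (mset (b # cs)) (1::'k::field) else 0)
          - (if y = b then Poly_Mapping.single (mset (a # cs)) 1 else 0))"
proof (induction cs rule: rev_induct)
  case Nil
  show ?case by (auto simp: lnormed_def magnus_mult_def magnus_gen_def fun_eq_iff)
next
  case (snoc c cs)
  have "lnormed magnus_mult (map magnus_gen (a # b # cs @ [c])) =
      magnus_mult (lnormed magnus_mult (map magnus_gen (a # b # cs))) (magnus_gen c)"
    using lnormed_snoc[of "map magnus_gen (a # b # cs)" magnus_mult "magnus_gen c"] by simp
  also have "\<dots> = (0, \<lambda>y. (if y = a then Poly_Mapping.single (mset (b # cs @ [c])) (1::'k) else 0)
          - (if y = b then Poly_Mapping.single (mset (a # cs @ [c])) 1 else 0))"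
    unfolding snoc
    by (auto simp: magnus_mult_def magnus_gen_def fun_eq_iff mult_single algebra_simps)
  finally show ?case by simp
qed

text \<open>These are coordinate functionals dual to the images of the basis words. The minus sign
  compensates the coefficient -1 of the characteristic term; the empty list is no word and gets the
  default 0.\<close>

fun magnus_dual :: "'x list \<Rightarrow> ('x, 'k::field) magnus \<Rightarrow> 'k" where
  "magnus_dual [] v = 0"
| "magnus_dual [a] v = Poly_Mapping.lookup (fst v) {#a#}"
| "magnus_dual (a # b # cs) v = - Poly_Mapping.lookup (snd v b) (mset (a # cs))"

lemma lookup_single_0_mult:
  "Poly_Mapping.lookup (Poly_Mapping.single 0 c * p) m = c * Poly_Mapping.lookup p m"
  for c :: "'k::field"
  by (simp add: Poly_Mapping.map.rep_eq when_def flip: mult_map_scale_conv_mult)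

lemma linear_magnus_dual:
  "Vector_Spaces.linear magnus_scale (*) (magnus_dual as :: ('x, 'k::field) magnus \<Rightarrow> 'k)"
  by (cases "(as, undefined :: ('x, 'k) magnus)" rule: magnus_dual.cases; unfold_locales)
    (simp_all add: lookup_add magnus_scale_def lookup_single_0_mult distrib_left distrib_right
      del: mset.simps)

lemma mlie_basis_words_cases:
  assumes "as \<in> mlie_basis_words"
  obtains (single) a where "as = [a]"
  | (long) a b cs where "as = a # b # cs" "a < b" "sorted (a # cs)"
proof (cases as)
  case (Cons a as')
  then show thesis
    using assms that by (cases as') (auto simp: mlie_basis_words_def)
qed (use assms in \<open>simp add: mlie_basis_words_def\<close>)

lemma magnus_dual_long:
  assumes "a < b" "sorted (a # cs)" "a' < b'" "sorted (a' # cs')"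
  shows "magnus_dual (a # b # cs)
      (lnormed magnus_mult (map magnus_gen (a' # b' # cs')) :: ('x::wellorder, 'k::field) magnus)
    = (if a # b # cs = a' # b' # cs' then 1 else 0)"
proof -
  \<comment> \<open>The positive term of the image could be read off only when
    \<open>b = a'\<close>. All its letters are at least \<open>a'\<close>, whereas \<open>a\<close>
    lies below \<open>b = a'\<close>, so its monomial is a different one.\<close>
  have "mset (b' # cs') \<noteq> mset (a # cs)" if "b = a'"
  proof
    assume "mset (b' # cs') = mset (a # cs)"
    then have "a \<in> set (b' # cs')" by (metis mset_eq_setD list.set_intros(1))
    then have "a' \<le> a" using assms(3,4) by auto
    then show False using assms(1) that by simp
  qed
  \<comment> \<open>For the negative term, a sorted list is recovered from its multiset.\<close>
  moreover have "mset (a' # cs') = mset (a # cs) \<longleftrightarrow> a' # cs' = a # cs"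
    using assms by (metis properties_for_sort sorted_sort_id)
  ultimately show ?thesis
    unfolding lnormed_magnus_gen magnus_dual.simps
    by (auto simp: lookup_minus lookup_single when_def simp del: mset.simps)
qed

lemma magnus_dual_basis:
  assumes "as \<in> mlie_basis_words" "bs \<in> mlie_basis_words"
  shows "magnus_dual as (lnormed magnus_mult (map magnus_gen bs) :: ('x::wellorder, 'k::field) magnus)
    = (if as = bs then 1 else 0)"
  using assms(1)
proof (cases rule: mlie_basis_words_cases)
  case as: (single a)
  from assms(2) show ?thesis
  proof (cases rule: mlie_basis_words_cases)
    case (single a')
    then show ?thesis using as
      by (simp add: lnormed_def magnus_gen_def lookup_single when_def)
  next
    case (long a' b' cs')
    then show ?thesis using as by (simp only: lnormed_magnus_gen magnus_dual.simps) simp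
  qed
next
  case as: (long a b cs)
  from assms(2) show ?thesis
  proof (cases rule: mlie_basis_words_cases)
    case (single a')
    \<comment> \<open>The second component of a generator has only constant entries, while the
      functional of a longer word reads a nonempty monomial.\<close>
    then show ?thesis using as
      by (simp add: lnormed_def magnus_gen_def lookup_one when_def)
  next
    case (long a' b' cs')
    then show ?thesis using as magnus_dual_long by metis
  qed
qed

section \<open>Words and leading words\<close>

lemma nf_deg_eq_length: "nf_deg w = nf_length w"
  by (simp add: nf_deg_def nf_length_def sum_list_triv)

lemma nf_length_simps [simp]: "nf_length (Gen a) = 1" "nf_length (Snoc u a) = Suc (nf_length u)"
  by (simp_all add: nf_length_def)

lemma less_nf_iff:
  "u < v \<longleftrightarrow> nf_length u < nf_length v \<or> nf_length u = nf_length v \<and> letters u < letters v"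
  by (auto simp: less_nf_def nf_deg_eq_length)

lemma nf_length_mono: "u \<le> v \<Longrightarrow> nf_length u \<le> nf_length v"
  by (auto simp: less_eq_nf_def less_nf_iff)

text \<open>Between words of equal length the comparison is decided before the appended letters are
  reached. Hence right multiplication by a generator respects leading words.\<close>

lemma Snoc_less_Snoc:
  assumes "u < v"
  shows "Snoc u a < Snoc v b"
proof (cases "nf_length u < nf_length v")
  case False
  then have "length (letters u) = length (letters v)" "letters u < letters v"
    using assms by (auto simp: less_nf_iff nf_length_def)
  then show ?thesis
    by (auto simp: less_nf_iff nf_length_def list_less_def lexord_sufI)
qed (simp add: less_nf_iff)

text \<open>Length is compared first, so the order embeds into \<open>lenlex\<close>; the
  lexicographic order on words of all lengths need not be well-founded.\<close>

lemma wf_less_nf: "wf {(u, v :: 'x::wellorder nf). u < v}"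
proof (rule wf_subset)
  show "wf (inv_image (lenlex {(a, b :: 'x). a < b}) letters)"
    by (intro wf_inv_image wf_lenlex wf)
  show "{(u, v :: 'x nf). u < v} \<subseteq> inv_image (lenlex {(a, b). a < b}) letters"
    by (auto simp: less_nf_iff nf_length_def list_less_def lenlex_def lexord_lex inv_image_def)
qed

text \<open>Naming the leading word explicitly avoids computing the maximum in \<open>lead\<close>,
  and the property passes easily through sums and products.\<close>

definition monic_at :: "'x::linorder nf \<Rightarrow> ('x, 'k::field) lb \<Rightarrow> bool" where
  "monic_at w f \<longleftrightarrow> Poly_Mapping.lookup f w = 1 \<and> Poly_Mapping.keys f \<subseteq> {..w}"

lemma monic_at_lead:
  assumes "monic_at w f"
  shows "lead f = w" "monic f"
proof -
  have "w \<in> Poly_Mapping.keys f" using assms by (simp add: monic_at_def in_keys_iff)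
  then show "lead f = w"
    unfolding lead_def using assms by (intro Max_eqI) (auto simp: monic_at_def)
  then show "monic f"
    using assms by (auto simp: monic_at_def monic_def)
qed

lemma lookup_lb_rmult_Gen:
  "Poly_Mapping.lookup (lb_rmult (Gen a) f) w =
    (case w of Gen b \<Rightarrow> 0 | Snoc u b \<Rightarrow> if b = a then Poly_Mapping.lookup f u else 0)"
proof -
  have "Poly_Mapping.lookup (lb_rmult (Gen a) f) w =
      (\<Sum>u\<in>Poly_Mapping.keys f. if w = Snoc u a then Poly_Mapping.lookup f u else 0)"
    by (subst lb_eq_sum[of f], simp only: lb_rmult.sum lb_rmult.scale lb_rmult_Gen_mono lookup_sum)
      (auto simp: lb_mono_def lookup_single when_def intro!: sum.cong)
  also have "\<dots> = (case w of Gen b \<Rightarrow> 0 | Snoc u b \<Rightarrow> if b = a then Poly_Mapping.lookup f u else 0)"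
    by (cases w) (auto simp: in_keys_iff)
  finally show ?thesis .
qed

lemma lb_mult_gen: "lb_mult f (lb_gen a) = lb_rmult (Gen a) f"
  by (simp add: lb_gen_def lb_mult_mono_right)

lemma monic_at_Snoc:
  assumes "monic_at w f"
  shows "monic_at (Snoc w a) (lb_mult f (lb_gen a))"
  using assms unfolding monic_at_def
  by (auto simp: lb_mult_gen lookup_lb_rmult_Gen in_keys_iff subset_iff
      less_eq_nf_def Snoc_less_Snoc split: nf.splits if_splits)

text \<open>Expanding a product by the Leibniz identity only rearranges letters, so no word becomes
  longer than the two factors together. The induction varies \<open>f\<close> and \<open>n\<close>
  because the recursion of \<open>lb_rmult\<close> also multiplies \<open>f\<close> by a
  generator.\<close>

lemma keys_lb_rmult_length:
  fixes f :: "('x, 'k::field) lb"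
  assumes "\<And>v. v \<in> Poly_Mapping.keys f \<Longrightarrow> nf_length v \<le> n"
    and "v \<in> Poly_Mapping.keys (lb_rmult w f)"
  shows "nf_length v \<le> n + nf_length w"
  using assms
proof (induction w arbitrary: f n v)
  case (Gen a)
  then show ?case
    by (auto simp: in_keys_iff lookup_lb_rmult_Gen split: nf.splits if_splits)
next
  case (Snoc w a)
  have gen: "nf_length u \<le> Suc m"
    if "\<And>u. u \<in> Poly_Mapping.keys g \<Longrightarrow> nf_length u \<le> m" "u \<in> Poly_Mapping.keys (lb_rmult (Gen a) g)"
    for g :: "('x, 'k) lb" and u m
    using that by (auto simp: in_keys_iff lookup_lb_rmult_Gen split: nf.splits if_splits)
  consider "v \<in> Poly_Mapping.keys (lb_rmult (Gen a) (lb_rmult w f))"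
    | "v \<in> Poly_Mapping.keys (lb_rmult w (lb_rmult (Gen a) f))"
    using Snoc.prems(2) keys_diff unfolding lb_rmult_Snoc by (metis UnE subsetD)
  then show ?case
  proof cases
    case 1
    then show ?thesis using gen[OF Snoc.IH[OF Snoc.prems(1)]] by simp
  next
    case 2
    then show ?thesis using Snoc.IH[OF gen[OF Snoc.prems(1)]] by simp
  qed
qed

section \<open>Reduction to basis words\<close>

lemma lb_mult_gen_gen: "lb_mult (lb_gen a) (lb_gen b) = lb_mono (Snoc (Gen a) b)"
  by (metis lb_gen_def lb_mult_mono_gen)

lemma mlie_relators_eq:
  "mlie_relators =
    {lb_mono (Snoc (Snoc \<mu> a) b) - lb_mono (Snoc (Snoc \<mu> b) a) | \<mu> a b. nf_length \<mu> \<ge> 2 \<and> b < a}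
    \<union> {lb_mono (Snoc (Snoc (Gen b) a) c) - lb_mono (Snoc (Snoc (Gen c) a) b)
        + lb_mono (Snoc (Snoc (Gen c) b) a) | a b c. c < b \<and> b < a}
    \<union> {lb_mono (Snoc (Gen a) b) + lb_mono (Snoc (Gen b) a) | a b. b < a}
    \<union> {lb_mono (Snoc (Gen d) d) | d. True}"
  by (simp add: mlie_relators_def lnormed_def lb_mult_gen_gen lb_mult_mono_gen)

lemma mlie_relatorsE:
  assumes "s \<in> mlie_relators"
  obtains (comm) \<mu> a b where
      "s = lb_mono (Snoc (Snoc \<mu> a) b) - lb_mono (Snoc (Snoc \<mu> b) a)" "nf_length \<mu> \<ge> 2" "b < a"
  | (jacobi) a b c where
      "s = lb_mono (Snoc (Snoc (Gen b) a) c) - lb_mono (Snoc (Snoc (Gen c) a) b)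
        + lb_mono (Snoc (Snoc (Gen c) b) a)" "c < b" "b < a"
  | (anti) a b where "s = lb_mono (Snoc (Gen a) b) + lb_mono (Snoc (Gen b) a)" "b < a"
  | (square) d where "s = lb_mono (Snoc (Gen d) d)"
  using assms unfolding mlie_relators_eq by blast

lemma lookup_lb_mono: "Poly_Mapping.lookup (lb_mono w) v = (if v = w then 1 else 0)"
  by (simp add: lb_mono_def lookup_single when_def)

lemma monic_at_mono: "monic_at w (lb_mono w)"
  by (auto simp: monic_at_def lookup_lb_mono in_keys_iff split: if_splits)

lemma monic_at_add_mono:
  assumes "monic_at w f" "v < w"
  shows "monic_at w (f + lb_mono v)"
proof -
  have "Poly_Mapping.keys (f + lb_mono v) \<subseteq> Poly_Mapping.keys f \<union> {v}"
    using keys_add[of f "lb_mono v"] by (simp add: lb_mono_def)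
  then show ?thesis
    using assms by (auto simp: monic_at_def lookup_add lookup_lb_mono)
qed

lemma monic_at_diff_mono:
  assumes "monic_at w f" "v < w"
  shows "monic_at w (f - lb_mono v)"
proof -
  have "Poly_Mapping.keys (f - lb_mono v) \<subseteq> Poly_Mapping.keys f \<union> {v}"
    using keys_diff[of f "lb_mono v"] by (simp add: lb_mono_def)
  then show ?thesis
    using assms by (auto simp: monic_at_def lookup_minus lookup_lb_mono)
qed

lemma monic_at_comm:
  assumes "b < a"
  shows "monic_at (Snoc (Snoc \<mu> a) b) (lb_mono (Snoc (Snoc \<mu> a) b) - lb_mono (Snoc (Snoc \<mu> b) a))"
proof -
  have "Snoc \<mu> b < Snoc \<mu> a"
    using assms by (simp add: less_nf_iff list_less_def lexord_append_leftI)
  then have "Snoc (Snoc \<mu> b) a < Snoc (Snoc \<mu> a) b" by (rule Snoc_less_Snoc)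
  then show ?thesis by (intro monic_at_diff_mono monic_at_mono)
qed

lemma Gen_less_Gen: "b < a \<Longrightarrow> Gen b < Gen a"
  by (simp add: less_nf_iff)

text \<open>The two other words start with \<open>c\<close>, which is smaller than \<open>b\<close>;
  the first letter already decides.\<close>

lemma monic_at_jacobi:
  assumes "c < b"
  shows "monic_at (Snoc (Snoc (Gen b) a) c)
    (lb_mono (Snoc (Snoc (Gen b) a) c) - lb_mono (Snoc (Snoc (Gen c) a) b)
      + lb_mono (Snoc (Snoc (Gen c) b) a))"
  using assms by (intro monic_at_add_mono monic_at_diff_mono monic_at_mono Snoc_less_Snoc Gen_less_Gen)

lemma monic_at_anti:
  assumes "b < a"
  shows "monic_at (Snoc (Gen a) b) (lb_mono (Snoc (Gen a) b) + lb_mono (Snoc (Gen b) a))"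
  using assms by (intro monic_at_add_mono monic_at_mono Snoc_less_Snoc Gen_less_Gen)

lemma monic_at_relator:
  assumes "s \<in> (mlie_relators :: ('x::wellorder, 'k::field) lb set)"
  obtains w where "monic_at w s" "nf_length w \<ge> 2"
  using assms
proof (cases rule: mlie_relatorsE)
  case (comm \<mu> a b)
  then show thesis by (intro that[of "Snoc (Snoc \<mu> a) b"]) (simp_all add: monic_at_comm)
next
  case (jacobi a b c)
  then show thesis by (intro that[of "Snoc (Snoc (Gen b) a) c"]) (simp_all add: monic_at_jacobi)
next
  case (anti a b)
  then show thesis by (intro that[of "Snoc (Gen a) b"]) (simp_all add: monic_at_anti)
next
  case (square d)
  then show thesis by (intro that[of "Snoc (Gen d) d"]) (simp_all add: monic_at_mono)
qed

text \<open>Leading words of relators have length at least 2, so normal polynomials with letters to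
  the left of \<open>s\<close> do not occur.\<close>

lemma normal_polys_of_relator:
  assumes "s \<in> mlie_relators"
  shows "normal_polys_of s = {lnormed lb_mult (s # map lb_gen as) | as. True}"
proof -
  obtain w where "monic_at w s" "nf_length w \<ge> 2" using assms by (rule monic_at_relator)
  then have "nf_length (lead s) \<noteq> 1" by (simp add: monic_at_lead)
  then show ?thesis by (simp add: normal_polys_of_def)
qed

lemma normal_polys_relators_induct [consumes 1, case_names relator mult]:
  assumes "h \<in> normal_polys mlie_relators"
    and relator: "\<And>s. s \<in> mlie_relators \<Longrightarrow> P s"
    and mult: "\<And>h a. P h \<Longrightarrow> P (lb_mult h (lb_gen a))"
  shows "P h"
proof -
  obtain s as where s: "s \<in> mlie_relators" and h: "h = lnormed lb_mult (s # map lb_gen as)"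
    using assms(1) by (auto simp: normal_polys_def normal_polys_of_relator)
  have "P (lnormed lb_mult (s # map lb_gen as))"
  proof (induction as rule: rev_induct)
    case Nil
    then show ?case using relator[OF s] by (simp add: lnormed_def)
  next
    case (snoc a as)
    then show ?case using mult by (simp add: lnormed_def)
  qed
  then show ?thesis by (simp add: h)
qed

lemma relator_in_normal_polys: "s \<in> S \<Longrightarrow> s \<in> normal_polys S"
  unfolding normal_polys_def normal_polys_of_def
  by (auto intro!: bexI[of _ s] exI[of _ "[]"] simp: lnormed_def)

lemma normal_polys_relators_mult:
  assumes "h \<in> normal_polys mlie_relators"
  shows "lb_mult h (lb_gen a) \<in> normal_polys mlie_relators"
proof -
  obtain s as where s: "s \<in> mlie_relators" and h: "h = lnormed lb_mult (s # map lb_gen as)"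
    using assms(1) by (auto simp: normal_polys_def normal_polys_of_relator)
  have "lb_mult h (lb_gen a) = lnormed lb_mult (s # map lb_gen (as @ [a]))"
    by (simp add: h lnormed_def)
  then have "lb_mult h (lb_gen a) \<in> normal_polys_of s"
    unfolding normal_polys_of_relator[OF s] by blast
  then show ?thesis using s unfolding normal_polys_def by blast
qed

lemma monic_at_lead_normal_poly:
  "h \<in> normal_polys mlie_relators \<Longrightarrow> monic_at (lead h) h"
proof (induction rule: normal_polys_relators_induct)
  case (relator s)
  then show ?case using monic_at_relator monic_at_lead by metis
next
  case (mult h a)
  then show ?case using monic_at_Snoc monic_at_lead by metis
qed

section \<open>Normal polynomials lie in the ideal\<close>

lemma anticommutator_in_ideal: "lb_mult x y + lb_mult y x \<in> mlie_ideal"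
proof -
  have "lb_mult (x + y) (x + y) - lb_mult x x - lb_mult y y \<in> mlie_ideal"
    by (intro mlie_ideal_diff mlie_ideal.square)
  then show ?thesis by (simp add: lb_multL.add lb_multR.add add.commute)
qed

lemma relator_in_ideal:
  assumes "s \<in> mlie_relators"
  shows "s \<in> mlie_ideal"
  using assms
proof (cases rule: mlie_relatorsE)
  case (comm \<mu> a b)
  \<comment> \<open>Length at least 2 makes \<open>\<mu>\<close> a product, so
    \<open>(\<mu>(ab))\<close> is a value of the metabelian identity; the Leibniz identity expands
    it to the relator.\<close>
  obtain \<nu> c where "\<mu> = Snoc \<nu> c" using comm(2) by (cases \<mu>) auto
  then have "lb_mult (lb_mono \<mu>) (lb_mult (lb_gen a) (lb_gen b)) \<in> mlie_ideal"
    by (simp add: mlie_ideal.metabelian flip: lb_mult_mono_gen)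
  then show ?thesis by (simp add: comm lb.leibniz lb_mult_mono_gen)
next
  case (jacobi a b c)
  let ?g = lb_gen
  \<comment> \<open>The relator is \<open>((ba)c) + (c(ba))\<close> with the second summand expanded
    by the Leibniz identity.\<close>
  have "lb_mult (lb_mult (?g b) (?g a)) (?g c) + lb_mult (?g c) (lb_mult (?g b) (?g a)) \<in> mlie_ideal"
    by (rule anticommutator_in_ideal)
  then show ?thesis
    unfolding lb.leibniz by (simp add: jacobi lb_mult_gen_gen lb_mult_mono_gen algebra_simps)
next
  case (anti a b)
  then show ?thesis
    using anticommutator_in_ideal[of "lb_gen a" "lb_gen b"] by (simp add: lb_mult_gen_gen)
next
  case (square d)
  then show ?thesis by (metis lb_mult_gen_gen mlie_ideal.square)
qed

lemma normal_poly_in_ideal: "h \<in> normal_polys mlie_relators \<Longrightarrow> h \<in> mlie_ideal"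
  by (induction rule: normal_polys_relators_induct)
    (simp_all add: relator_in_ideal mlie_ideal.mult_right)

section \<open>Division of words by normal polynomials\<close>

abbreviation mlie_irreducible :: "'x::wellorder nf set" where
  "mlie_irreducible \<equiv> {w. letters w \<in> mlie_basis_words}"

text \<open>If the prefix is already reducible, its normal polynomial is multiplied by the last
  letter. Otherwise the last letter itself breaks a condition on basis words, and the length of the
  word selects the relator.\<close>

lemma ex_normal_poly_lead:
  assumes "w \<notin> mlie_irreducible"
  obtains h :: "('x::wellorder, 'k::field) lb"
  where "h \<in> normal_polys mlie_relators" "monic_at w h"
proof -
  have "\<exists>h \<in> normal_polys mlie_relators. monic_at w (h :: ('x, 'k) lb)"
    using assms
  proof (induction w)
    case (Gen a)
    then show ?case by (simp add: mlie_basis_words_def)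
  next
    case (Snoc u a)
    have relator: ?case if "s \<in> mlie_relators" "monic_at (Snoc u a) s" for s :: "('x, 'k) lb"
      using that relator_in_normal_polys by blast
    show ?case
    proof (cases "u \<in> mlie_irreducible")
      case False
      then show ?thesis
        using Snoc.IH normal_polys_relators_mult monic_at_Snoc by blast
    next
      case irr: True
      show ?thesis
      proof (cases u)
        case (Gen b)
        then have "a \<le> b" using Snoc.prems by (simp add: mlie_basis_words_def)
        then consider "a < b" | "a = b" by fastforce
        then show ?thesis
        proof cases
          case 1
          then show ?thesis using monic_at_anti[of a b] Gen
            by (intro relator) (auto simp: mlie_relators_eq)
        next
          case 2
          then show ?thesis using monic_at_mono[of "Snoc (Gen b) b"] Gen
            by (intro relator) (auto simp: mlie_relators_eq)
        qed
      next
        case u: (Snoc v b)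
        show ?thesis
        proof (cases v)
          case (Gen c)
          \<comment> \<open>The word is \<open>cba\<close> with \<open>a < c < b\<close>, the
            leading word of the three-letter relator after renaming.\<close>
          then have "c < b" "a < c" using Snoc.prems irr u by (auto simp: mlie_basis_words_def)
          then show ?thesis using monic_at_jacobi[of a c b] Gen u
            by (intro relator) (auto simp: mlie_relators_eq)
        next
          case v: (Snoc v' c)
          obtain x y zs where l: "letters v = x # y # zs"
            using v by (cases "letters v"; cases "tl (letters v)") (auto simp: neq_Nil_conv)
          have "sorted (x # zs @ [b])" "x < y" "\<not> sorted (x # zs @ [b, a])"
            using irr Snoc.prems u l by (auto simp: mlie_basis_words_def)
          \<comment> \<open>The tail was sorted up to \<open>b\<close>, so appending
            \<open>a\<close> can fail only through a descent from \<open>b\<close> to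
            \<open>a\<close>, which the commutation relator handles.\<close>
          then have "a < b" by (fastforce simp: sorted_append)
          moreover have "nf_length v \<ge> 2" using l by (simp add: nf_length_def)
          ultimately show ?thesis using monic_at_comm[of a b v] u
            by (intro relator[of "lb_mono (Snoc (Snoc v b) a) - lb_mono (Snoc (Snoc v a) b)"])
              (unfold mlie_relators_eq, blast, simp)
        qed
      qed
    qed
  qed
  then show thesis using that by blast
qed

lemma in_span_monos:
  assumes "\<And>v. v \<in> Poly_Mapping.keys f \<Longrightarrow> lb_mono v \<in> lb.span B"
  shows "f \<in> lb.span B"
  by (subst lb_eq_sum) (intro lb.span_sum lb.span_scale assms)

text \<open>This is division with remainder by well-founded induction: a reducible word is replaced
  by the smaller words of a normal polynomial that it leads. The bound on \<open>lead h\<close>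
  survives every step and yields both triviality conditions later.\<close>

lemma mono_in_span_normal_irreducible:
  "lb_mono w \<in> lb.span ({h \<in> normal_polys mlie_relators. lead h \<le> w}
    \<union> lb_mono ` mlie_irreducible :: ('x::wellorder, 'k::field) lb set)"
proof (induction w rule: wf_induct_rule[OF wf_less_nf])
  case (1 w)
  let ?B = "\<lambda>w. {h \<in> normal_polys mlie_relators. lead h \<le> w} \<union> lb_mono ` mlie_irreducible :: ('x, 'k) lb set"
  show ?case
  proof (cases "w \<in> mlie_irreducible")
    case True
    then show ?thesis by (intro lb.span_base) blast
  next
    case False
    then obtain h :: "('x, 'k) lb" where h: "h \<in> normal_polys mlie_relators" "monic_at w h"
      by (rule ex_normal_poly_lead)
    have "h - lb_mono w \<in> lb.span (?B w)"
    proof (rule in_span_monos)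
      fix v
      assume v: "v \<in> Poly_Mapping.keys (h - lb_mono w)"
      then have "v < w"
        using h(2) by (auto simp: monic_at_def in_keys_iff lookup_minus lookup_lb_mono
            subset_iff order_less_le split: if_splits)
      moreover from this have "?B v \<subseteq> ?B w" by auto
      ultimately show "lb_mono v \<in> lb.span (?B w)"
        using "1.IH"[of v] subsetD[OF lb.span_mono[of "?B v" "?B w"]] by simp
    qed
    moreover have "h \<in> lb.span (?B w)"
      using h by (intro lb.span_base) (simp add: monic_at_lead)
    ultimately have "h - (h - lb_mono w) \<in> lb.span (?B w)"
      using lb.span_diff by blast
    then show ?thesis by simp
  qed
qed

section \<open>Independence of the basis words\<close>

lemma abs_mlie_eq_0_iff: "abs_mlie f = 0 \<longleftrightarrow> f \<in> mlie_ideal"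
  by (simp add: zero_mlie_def mlie.abs_eq_iff mlie_rel_def)

lemma linear_abs_mlie: "Vector_Spaces.linear lb_scale mlie_scale abs_mlie"
  by unfold_locales (simp_all add: plus_mlie.abs_eq mlie_scale.abs_eq)

interpretation abs_mlie: Vector_Spaces.linear lb_scale mlie_scale abs_mlie
  by (rule linear_abs_mlie)

lemma abs_mlie_mono: "abs_mlie (lb_mono w) = lnormed mlie_mult (map mlie_gen (letters w))"
proof -
  have "abs_mlie (lnormed lb_mult (map lb_gen (letters w)))
      = lnormed mlie_mult (map abs_mlie (map lb_gen (letters w)))"
    by (rule hom_lnormed) (simp_all add: mlie_mult.abs_eq)
  then show ?thesis by (simp add: lb_mono_eq_lnormed o_def mlie_gen_def map_fun_def)
qed

text \<open>The universal property of \<open>mlie_free\<close> gives a homomorphism to the Magnus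
  algebra, along which the functionals \<open>magnus_dual\<close> are pulled back.\<close>

lemma ex_mlie_dual:
  obtains d :: "'x::wellorder list \<Rightarrow> ('x, 'k::field) mlie \<Rightarrow> 'k"
  where "\<And>as. Vector_Spaces.linear mlie_scale (*) (d as)"
    and "\<And>as bs. as \<in> mlie_basis_words \<Longrightarrow> bs \<in> mlie_basis_words \<Longrightarrow>
      d as (lnormed mlie_mult (map mlie_gen bs)) = (if as = bs then 1 else 0)"
proof -
  obtain h :: "('x, 'k) mlie \<Rightarrow> ('x, 'k) magnus"
    where h: "algebra_hom mlie_scale mlie_mult magnus_scale magnus_mult h"
      and gen: "\<And>a. h (mlie_gen a) = magnus_gen a"
    using mlie_free[OF magnus.metabelian_lie_algebra_axioms, of magnus_gen] by blast
  show thesis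
  proof (rule that[of "\<lambda>as. magnus_dual as \<circ> h"])
    show "Vector_Spaces.linear mlie_scale (*) (magnus_dual as \<circ> h)" for as
      using h by (auto intro!: Vector_Spaces.linear_compose[OF _ linear_magnus_dual] simp: algebra_hom_def)
    show "(magnus_dual as \<circ> h) (lnormed mlie_mult (map mlie_gen bs)) = (if as = bs then 1 else 0)"
      if "as \<in> mlie_basis_words" "bs \<in> mlie_basis_words" for as bs
    proof -
      have "bs \<noteq> []" using that by (auto simp: mlie_basis_words_def)
      then have "h (lnormed mlie_mult (map mlie_gen bs)) = lnormed magnus_mult (map magnus_gen bs)"
        using h by (subst hom_lnormed[where m' = magnus_mult]) (simp_all add: algebra_hom_def o_def gen)
      then show ?thesis using magnus_dual_basis[OF that] by simp
    qed
  qed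
qed

lemma inj_on_basis_words:
  "inj_on (\<lambda>as. lnormed mlie_mult (map mlie_gen as) :: ('x::wellorder, 'k::field) mlie) mlie_basis_words"
proof (rule inj_onI)
  fix as bs :: "'x list"
  assume *: "as \<in> mlie_basis_words" "bs \<in> mlie_basis_words"
    "lnormed mlie_mult (map mlie_gen as) = (lnormed mlie_mult (map mlie_gen bs) :: ('x, 'k) mlie)"
  obtain d :: "'x list \<Rightarrow> ('x, 'k) mlie \<Rightarrow> 'k" where
    "\<And>as. Vector_Spaces.linear mlie_scale (*) (d as)" and
    dual: "\<And>as bs. as \<in> mlie_basis_words \<Longrightarrow> bs \<in> mlie_basis_words \<Longrightarrow>
      d as (lnormed mlie_mult (map mlie_gen bs)) = (if as = bs then 1 else 0)"
    by (rule ex_mlie_dual) blast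
  have "d as (lnormed mlie_mult (map mlie_gen as)) = d as (lnormed mlie_mult (map mlie_gen bs))"
    by (simp only: *(3))
  then have "(if as = bs then 1 else 0 :: 'k) = 1"
    unfolding dual[OF *(1,2)] dual[OF *(1,1)] by simp
  then show "as = bs" by (simp split: if_splits)
qed

lemma independent_basis_words:
  "mlie.independent
    {lnormed mlie_mult (map mlie_gen as) :: ('x::wellorder, 'k::field) mlie | as. as \<in> mlie_basis_words}"
proof -
  let ?m = "\<lambda>as. lnormed mlie_mult (map mlie_gen as) :: ('x, 'k) mlie"
  obtain d :: "'x list \<Rightarrow> ('x, 'k) mlie \<Rightarrow> 'k" where
    lin: "\<And>as. Vector_Spaces.linear mlie_scale (*) (d as)" and
    dual: "\<And>as bs. as \<in> mlie_basis_words \<Longrightarrow> bs \<in> mlie_basis_words \<Longrightarrow>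
      d as (?m bs) = (if as = bs then 1 else 0)"
    using ex_mlie_dual by blast
  have "u v = 0" if T: "finite T" "T \<subseteq> ?m ` mlie_basis_words"
    and sum: "(\<Sum>v\<in>T. mlie_scale (u v) v) = 0" and v: "v \<in> T" for T u v
  proof -
    obtain as where as: "as \<in> mlie_basis_words" "v = ?m as" using T v by blast
    interpret d: Vector_Spaces.linear mlie_scale "(*)" "d as" by (rule lin)
    \<comment> \<open>Duality is stated for words; injectivity turns it into a statement about the
      elements of \<open>T\<close>.\<close>
    have "d as w = (if w = v then 1 else 0)" if "w \<in> T" for w
      using that T(2) as dual inj_on_basis_words[THEN inj_onD] by fastforce
    then have "(\<Sum>w\<in>T. u w * d as w) = (\<Sum>w\<in>T. if w = v then u v else 0)"
      by (intro sum.cong) auto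
    also have "\<dots> = u v" using T v by simp
    finally have "u v = d as (\<Sum>v\<in>T. mlie_scale (u v) v)"
      by (simp add: d.sum d.scale)
    then show ?thesis using sum by (simp add: d.zero)
  qed
  then have "mlie.independent (?m ` mlie_basis_words)"
    unfolding mlie.independent_explicit_module by blast
  then show ?thesis by (simp add: Setcompr_eq_image)
qed

text \<open>The image of \<open>f\<close> in the quotient is 0, and the dual functionals recover
  every coefficient of \<open>f\<close> from that image.\<close>

lemma irreducible_combination_in_ideal:
  assumes "f \<in> lb.span (lb_mono ` mlie_irreducible)"
    and "f \<in> (mlie_ideal :: ('x::wellorder, 'k::field) lb set)"
  shows "f = 0"
proof (rule poly_mapping_eqI)
  fix w
  have keys: "Poly_Mapping.keys f \<subseteq> mlie_irreducible"
    using assms(1)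
  proof (induction rule: lb.span_induct_alt)
    case (step c x y)
    then show ?case
      by (auto simp: in_keys_iff lookup_add lookup_lb_mono subset_iff split: if_splits)
  qed simp
  obtain d :: "'x list \<Rightarrow> ('x, 'k) mlie \<Rightarrow> 'k" where
    lin: "\<And>as. Vector_Spaces.linear mlie_scale (*) (d as)" and
    dual: "\<And>as bs. as \<in> mlie_basis_words \<Longrightarrow> bs \<in> mlie_basis_words \<Longrightarrow>
      d as (lnormed mlie_mult (map mlie_gen bs)) = (if as = bs then 1 else 0)"
    using ex_mlie_dual by blast
  show "Poly_Mapping.lookup f w = Poly_Mapping.lookup 0 w"
  proof (cases "w \<in> mlie_irreducible")
    case True
    interpret d: Vector_Spaces.linear mlie_scale "(*)" "d (letters w)" by (rule lin)
    have "0 = d (letters w) (abs_mlie f)"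
      using assms(2) by (simp add: abs_mlie_eq_0_iff[THEN iffD2] d.zero)
    also have "\<dots> = (\<Sum>v\<in>Poly_Mapping.keys f. Poly_Mapping.lookup f v * d (letters w) (abs_mlie (lb_mono v)))"
      by (subst lb_eq_sum[of f]) (simp add: abs_mlie.sum abs_mlie.scale d.sum d.scale)
    also have "\<dots> = (\<Sum>v\<in>Poly_Mapping.keys f. if v = w then Poly_Mapping.lookup f w else 0)"
      using keys True by (intro sum.cong) (auto simp: abs_mlie_mono dual subset_iff dest: letters_inject)
    also have "\<dots> = Poly_Mapping.lookup f w" by (simp add: in_keys_iff)
    finally show ?thesis by simp
  next
    case False
    then show ?thesis using keys by (auto simp: in_keys_iff)
  qed
qed

section \<open>Groebner-Shirshov property and linear basis\<close>

lemma ideal_element_in_span_normal_polys: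
  assumes "f \<in> mlie_ideal" "f \<in> lb.span (N \<union> lb_mono ` mlie_irreducible)"
    and "N \<subseteq> normal_polys mlie_relators"
  shows "f \<in> lb.span N"
proof -
  obtain n r where f: "f = n + r" and n: "n \<in> lb.span N" and r: "r \<in> lb.span (lb_mono ` mlie_irreducible)"
    using assms(2) unfolding lb.span_Un by blast
  have "n \<in> mlie_ideal"
    using n
  proof (induction rule: lb.span_induct_alt)
    case base
    show ?case by (rule mlie_ideal_zero)
  next
    case (step c x y)
    then show ?case
      using assms(3) mlie_ideal.add[OF mlie_ideal.scale[OF normal_poly_in_ideal]] by blast
  qed
  \<comment> \<open>The remainder \<open>r = f - n\<close> is both in the ideal and a combination of
    irreducible words, hence 0. Keeping \<open>N\<close> arbitrary lets this argument serve the
    bound by a word as well as the bound by degree.\<close>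
  then have "f - n \<in> mlie_ideal" using assms(1) by (intro mlie_ideal_diff)
  then have "r = 0" using r by (intro irreducible_combination_in_ideal) (simp_all add: f)
  then show ?thesis using f n by simp
qed

lemma groebner_shirshov_basis_mlie_relators:
  "groebner_shirshov_basis (mlie_relators :: ('x::wellorder, 'k::field) lb set)"
  unfolding groebner_shirshov_basis_def
proof (intro conjI ballI allI impI)
  let ?S = "mlie_relators :: ('x, 'k) lb set"
  let ?I = "lb_mono ` mlie_irreducible :: ('x, 'k) lb set"
  show "monic s" if "s \<in> ?S" for s
    using that monic_at_relator monic_at_lead(2) by metis
  show "trivial_mod ?S (lead f) (f - h)"
    if f: "f \<in> ?S" and g: "g \<in> ?S" and h: "h \<in> normal_polys_of g" and fh: "f \<noteq> g \<and> lead f = lead h"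
    for f g h
    unfolding trivial_mod_def
  proof (rule ideal_element_in_span_normal_polys)
    have hN: "h \<in> normal_polys ?S" using g h by (auto simp: normal_polys_def)
    show "f - h \<in> mlie_ideal"
      using f hN by (intro mlie_ideal_diff relator_in_ideal normal_poly_in_ideal)
    have mon: "monic_at (lead f) f" "monic_at (lead f) h"
      using monic_at_lead_normal_poly[OF hN] monic_at_lead_normal_poly[OF relator_in_normal_polys[OF f]]
        fh by simp_all
    show "f - h \<in> lb.span ({h \<in> normal_polys ?S. lead h < lead f} \<union> ?I)"
    proof (rule in_span_monos)
      fix v
      assume "v \<in> Poly_Mapping.keys (f - h)"
      \<comment> \<open>Both leading coefficients are 1 at the same word, so that word cancels in
        \<open>f - h\<close>.\<close>
      then have "v < lead f"
        using mon keys_diff[of f h] by (auto simp: monic_at_def in_keys_iff lookup_minus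
            subset_iff order_less_le)
      then have "{h \<in> normal_polys ?S. lead h \<le> v} \<union> ?I
          \<subseteq> {h \<in> normal_polys ?S. lead h < lead f} \<union> ?I" by auto
      then show "lb_mono v \<in> lb.span ({h \<in> normal_polys ?S. lead h < lead f} \<union> ?I)"
        using mono_in_span_normal_irreducible lb.span_mono by blast
    qed
  qed blast
  show "trivial_mod_deg ?S (nf_deg \<mu> + nf_deg (lead f)) (lb_mult (lb_mono \<mu>) f)"
    if f: "f \<in> ?S" for f \<mu>
    unfolding trivial_mod_deg_def
  proof (rule ideal_element_in_span_normal_polys)
    let ?N = "{h \<in> normal_polys ?S. nf_deg (lead h) \<le> nf_deg \<mu> + nf_deg (lead f)}"
    show "lb_mult (lb_mono \<mu>) f \<in> mlie_ideal"
      using f by (intro mlie_ideal.mult_left relator_in_ideal)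
    \<comment> \<open>Only the degree is bounded here, so each word of \<open>f\<close> can be
      treated separately: division of words never raises the length.\<close>
    have "lb_mult (lb_mono \<mu>) (lb_mono w) \<in> lb.span (?N \<union> ?I)" if "w \<in> Poly_Mapping.keys f" for w
    proof (rule in_span_monos)
      fix v
      assume "v \<in> Poly_Mapping.keys (lb_mult (lb_mono \<mu>) (lb_mono w) :: ('x, 'k) lb)"
      then have "nf_length v \<le> nf_length \<mu> + nf_length w"
        unfolding lb_mult_mono_right
        by (rule keys_lb_rmult_length[rotated]) (auto simp: in_keys_iff lookup_lb_mono split: if_splits)
      moreover have "w \<le> lead f"
        using that monic_at_lead_normal_poly[OF relator_in_normal_polys[OF f]]
        by (auto simp: monic_at_def)
      ultimately have "nf_length v \<le> nf_deg \<mu> + nf_deg (lead f)"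
        using nf_length_mono by (fastforce simp: nf_deg_eq_length)
      then have "{h \<in> normal_polys ?S. lead h \<le> v} \<union> ?I \<subseteq> ?N \<union> ?I"
        using nf_length_mono by (fastforce simp: nf_deg_eq_length)
      then show "lb_mono v \<in> lb.span (?N \<union> ?I)"
        using mono_in_span_normal_irreducible lb.span_mono by blast
    qed
    then show "lb_mult (lb_mono \<mu>) f \<in> lb.span (?N \<union> ?I)"
      by (subst lb_eq_sum[of f]) (simp add: lb_multR.sum lb_multR.scale lb.span_sum lb.span_scale)
  qed blast
qed

text \<open>Normal polynomials vanish in the quotient, so the division of words leaves only the
  images of irreducible words.\<close>

lemma span_basis_words:
  "mlie.span {lnormed mlie_mult (map mlie_gen as) :: ('x::wellorder, 'k::field) mlie | as.
    as \<in> mlie_basis_words} = UNIV"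
proof -
  let ?B = "{lnormed mlie_mult (map mlie_gen as) :: ('x, 'k) mlie | as. as \<in> mlie_basis_words}"
  have "abs_mlie f \<in> mlie.span ?B" if "f \<in> lb.span (normal_polys mlie_relators \<union> lb_mono ` mlie_irreducible)"
    for f :: "('x, 'k) lb"
    using that
  proof (induction rule: lb.span_induct_alt)
    case base
    then show ?case by (simp add: abs_mlie.zero mlie.span_zero)
  next
    case (step c x y)
    have "abs_mlie x \<in> mlie.span ?B"
      using step(1)
    proof
      assume "x \<in> normal_polys mlie_relators"
      then show ?thesis
        by (simp add: normal_poly_in_ideal abs_mlie_eq_0_iff[THEN iffD2] mlie.span_zero)
    next
      assume "x \<in> lb_mono ` mlie_irreducible"
      then show ?thesis by (auto simp: abs_mlie_mono intro!: mlie.span_base)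
    qed
    then show ?case
      using step(2) by (simp add: abs_mlie.add abs_mlie.scale mlie.span_add mlie.span_scale)
  qed
  moreover have "f \<in> lb.span (normal_polys mlie_relators \<union> lb_mono ` mlie_irreducible)" for f :: "('x, 'k) lb"
  proof (rule in_span_monos)
    show "lb_mono v \<in> lb.span (normal_polys mlie_relators \<union> lb_mono ` mlie_irreducible :: ('x, 'k) lb set)" for v
      using mono_in_span_normal_irreducible[of v, where 'k = 'k]
      by (rule lb.span_mono[THEN subsetD, rotated]) auto
  qed
  ultimately have "abs_mlie f \<in> mlie.span ?B" for f by blast
  from this[of "rep_mlie x" for x] have "x \<in> mlie.span ?B" for x
    by (simp add: Quotient3_abs_rep[OF Quotient3_mlie])
  then show ?thesis by blast
qed

text \<open>The injectivity clause ensures that the set in the last clause is truly indexed by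
  words, with no two of them collapsing to one element.\<close>

theorem theorem5p11:
  shows "groebner_shirshov_basis (mlie_relators :: ('x::wellorder, 'k::field) lb set)
    \<and> inj_on (\<lambda>as. lnormed mlie_mult (map mlie_gen as) :: ('x, 'k) mlie) mlie_basis_words
    \<and> linear_basis mlie_scale
        {lnormed mlie_mult (map mlie_gen as) :: ('x, 'k) mlie | as. as \<in> mlie_basis_words}"
  using groebner_shirshov_basis_mlie_relators inj_on_basis_words independent_basis_words
    span_basis_words
  unfolding linear_basis_def by blast

end
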